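(* Let $\hat{\mathcal{F}}(X)$ be the set of cyclically reduced words on a set $X$, equipped with the cyclically reduced product $*$. Then: (1) for every word $w$ one has $w*1=1*w=\hat\rho(w)$; thus $1$ is an identity element of $(\hat{\mathcal{F}}(X),* )$; (2) $1$ is the unique idempotent of $(\hat{\mathcal{F}}(X),* )$, and hence the unique identity element; (3) for each $u\in\hat{\mathcal{F}}(X)$, the word $u^{-1}$ (the inverse of $u$ in the free group) is the unique left inverse and the unique right inverse of $u$ in $(\hat{\mathcal{F}}(X),* )$.
   Context: Words are elements of the free monoid $\mathcal{M}(X\cup X^{-1})$; $1$ is the empty word; juxtaposition is concatenation; $(y_1\cdots y_n)^{-1}=y_n^{-1}\cdots y_1^{-1}$. $\rho(w)$ is the reduced form of $w$. A reduced word is cyclically reduced if its last letter is not the inverse of its first letter (the word $1$ is cyclically reduced). For every word $w$ there are unique reduced $t$ and cyclically reduced $c$ with $\rho(w)=tct^{-1}$ as concatenation; $\hat\rho(w):=c$. The cyclically reduced product of words is $u*v:=\hat\rho(uv)$. An idempotent is an element $w$ with $w*w=w$. *)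

theory Defs
  imports Main
begin

datatype 'a letter = Gen 'a | Inv 'a

fun linv :: "'a letter \<Rightarrow> 'a letter" where
  "linv (Gen x) = Inv x"
| "linv (Inv x) = Gen x"

type_synonym 'a word = "'a letter list"

definition words :: "'a set \<Rightarrow> 'a word set" where
  "words X = lists (Gen ` X \<union> Inv ` X)"

definition winv :: "'a word \<Rightarrow> 'a word" where
  "winv w = rev (map linv w)"

inductive cancels :: "'a word \<Rightarrow> 'a word \<Rightarrow> bool" where
  "cancels (p @ [x, linv x] @ q) (p @ q)"

definition reduced :: "'a word \<Rightarrow> bool" where
  "reduced w \<longleftrightarrow> (\<nexists>p x q. w = p @ [x, linv x] @ q)"

definition reduced_form :: "'a word \<Rightarrow> 'a word" where
  "reduced_form w = (THE v. reduced v \<and> cancels\<^sup>*\<^sup>* w v)"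

definition cyclically_reduced :: "'a word \<Rightarrow> bool" where
  "cyclically_reduced w \<longleftrightarrow> reduced w \<and> (w \<noteq> [] \<longrightarrow> last w \<noteq> linv (hd w))"

definition cyclically_reduced_form :: "'a word \<Rightarrow> 'a word" where
  "cyclically_reduced_form w =
    (THE c. cyclically_reduced c \<and> (\<exists>t. reduced t \<and> reduced_form w = t @ c @ winv t))"

definition cyclically_reduced_words :: "'a set \<Rightarrow> 'a word set" where
  "cyclically_reduced_words X = {w \<in> words X. cyclically_reduced w}"

definition cprod :: "'a word \<Rightarrow> 'a word \<Rightarrow> 'a word"  (infixl \<open>\<circledast>\<close> 70) where
  "u \<circledast> v = cyclically_reduced_form (u @ v)"

definition identity_in :: "'b set \<Rightarrow> ('b \<Rightarrow> 'b \<Rightarrow> 'b) \<Rightarrow> 'b \<Rightarrow> bool" where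
  "identity_in M f e \<longleftrightarrow> e \<in> M \<and> (\<forall>x\<in>M. f e x = x \<and> f x e = x)"

definition idempotent_in :: "'b set \<Rightarrow> ('b \<Rightarrow> 'b \<Rightarrow> 'b) \<Rightarrow> 'b \<Rightarrow> bool" where
  "idempotent_in M f e \<longleftrightarrow> e \<in> M \<and> f e e = e"

(* Inverses are taken with respect to a given element e, which is meant to be an identity. *)
definition left_inverse_in :: "'b set \<Rightarrow> ('b \<Rightarrow> 'b \<Rightarrow> 'b) \<Rightarrow> 'b \<Rightarrow> 'b \<Rightarrow> 'b \<Rightarrow> bool" where
  "left_inverse_in M f e x y \<longleftrightarrow> y \<in> M \<and> f y x = e"

definition right_inverse_in :: "'b set \<Rightarrow> ('b \<Rightarrow> 'b \<Rightarrow> 'b) \<Rightarrow> 'b \<Rightarrow> 'b \<Rightarrow> 'b \<Rightarrow> bool" where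
  "right_inverse_in M f e x y \<longleftrightarrow> y \<in> M \<and> f x y = e"

(* The lemmas below show that the two definite descriptions are well defined and that
   the product is an operation on cyclically_reduced_words X. *)

lemma linv_linv [simp]: "linv (linv x) = x"
  by (cases x) auto

lemma linv_eq_iff: "linv x = y \<longleftrightarrow> x = linv y"
  by auto

lemma winv_Nil [simp]: "winv [] = []"
  by (simp add: winv_def)

lemma winv_Cons [simp]: "winv (x # w) = winv w @ [linv x]"
  by (simp add: winv_def)

fun push :: "'a letter \<Rightarrow> 'a word \<Rightarrow> 'a word" where
  "push x [] = [x]"
| "push x (y # w) = (if y = linv x then w else x # y # w)"

lemma reduced_Nil [simp]: "reduced []"
  by (simp add: reduced_def)

lemma reduced_Cons:
  "reduced (x # w) \<longleftrightarrow> reduced w \<and> (w \<noteq> [] \<longrightarrow> hd w \<noteq> linv x)"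
proof
  assume r: "reduced (x # w)"
  have "reduced w"
    unfolding reduced_def
  proof (intro notI, elim exE)
    fix p y q assume "w = p @ [y, linv y] @ q"
    then have "x # w = (x # p) @ [y, linv y] @ q" by simp
    then show False using r unfolding reduced_def by blast
  qed
  moreover have "hd w \<noteq> linv x" if "w \<noteq> []"
  proof
    assume "hd w = linv x"
    then have "x # w = [] @ [x, linv x] @ tl w" using that by (cases w) auto
    then show False using r unfolding reduced_def by blast
  qed
  ultimately show "reduced w \<and> (w \<noteq> [] \<longrightarrow> hd w \<noteq> linv x)" by blast
next
  assume r: "reduced w \<and> (w \<noteq> [] \<longrightarrow> hd w \<noteq> linv x)"
  show "reduced (x # w)"
    unfolding reduced_def
  proof (intro notI, elim exE)
    fix p y q assume e: "x # w = p @ [y, linv y] @ q"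
    show False
    proof (cases p)
      case Nil
      then show False using e r by auto
    next
      case (Cons a p')
      then have "w = p' @ [y, linv y] @ q" using e by simp
      then show False using r unfolding reduced_def by blast
    qed
  qed
qed

lemma reduced_append_left: "reduced (u @ v) \<Longrightarrow> reduced u"
  by (induction u) (auto simp: reduced_Cons)

lemma reduced_push: "reduced w \<Longrightarrow> reduced (push x w)"
  by (cases w) (auto simp: reduced_Cons)

lemma reduced_foldr: "reduced w \<Longrightarrow> reduced (foldr push u w)"
  by (induction u) (auto simp: reduced_push)

lemma push_push: "reduced w \<Longrightarrow> push x (push (linv x) w) = w"
  by (cases w; cases "tl w") (auto simp: reduced_Cons)

lemma foldr_push_reduced: "reduced w \<Longrightarrow> foldr push w [] = w"
proof (induction w)
  case (Cons x w)
  then show ?case by (cases w) (auto simp: reduced_Cons)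
qed simp

lemma foldr_push_cancels: "cancels u v \<Longrightarrow> foldr push u [] = foldr push v []"
  by (induction rule: cancels.induct) (simp add: push_push reduced_foldr)

lemma foldr_push_rtranclp:
  "cancels\<^sup>*\<^sup>* u v \<Longrightarrow> foldr push u [] = foldr push v []"
  by (induction rule: rtranclp_induct) (auto dest: foldr_push_cancels)

lemma ex_reduced_form: "\<exists>v. reduced v \<and> cancels\<^sup>*\<^sup>* w v"
proof (induction w rule: length_induct)
  case (1 w)
  show ?case
  proof (cases "reduced w")
    case False
    then obtain p x q where w: "w = p @ [x, linv x] @ q"
      unfolding reduced_def by blast
    then have c: "cancels w (p @ q)" using cancels.intros by blast
    obtain v where "reduced v" "cancels\<^sup>*\<^sup>* (p @ q) v"
      using 1 w by (auto dest: spec[of _ "p @ q"])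
    then show ?thesis using c by (meson converse_rtranclp_into_rtranclp)
  qed blast
qed

lemma ex1_reduced_form: "\<exists>!v. reduced v \<and> cancels\<^sup>*\<^sup>* w v"
  using ex_reduced_form[of w] by (metis foldr_push_reduced foldr_push_rtranclp)

lemma reduced_reduced_form: "reduced (reduced_form w)"
  and cancels_reduced_form: "cancels\<^sup>*\<^sup>* w (reduced_form w)"
  using theI'[OF ex1_reduced_form[of w]] by (simp_all add: reduced_form_def)

lemma ex_cyclic_decomposition:
  "reduced w \<Longrightarrow> \<exists>t c. reduced t \<and> cyclically_reduced c \<and> w = t @ c @ winv t"
proof (induction w rule: length_induct)
  case (1 w)
  show ?case
  proof (cases "cyclically_reduced w")
    case True
    then show ?thesis by (intro exI[of _ "[]"] exI[of _ w]) simp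
  next
    case False
    then have ne: "w \<noteq> []" and l: "last w = linv (hd w)"
      using 1 by (auto simp: cyclically_reduced_def)
    obtain x v where wx: "w = x # v" using ne by (cases w) auto
    have "x \<noteq> linv x" by (cases x) auto
    then have "v \<noteq> []" using l wx by auto
    then obtain m where w: "w = x # m @ [linv x]"
      using l wx by (metis append_butlast_last_id last_ConsR list.sel(1))
    have "reduced m" using 1(2) w by (auto simp: reduced_Cons dest: reduced_append_left)
    then obtain t c where tc: "reduced t" "cyclically_reduced c" "m = t @ c @ winv t"
      using 1(1) w by (auto dest: spec[of _ m])
    have e: "w = (x # t) @ c @ winv (x # t)" using w tc by simp
    then have "reduced (x # t)" using 1(2) reduced_append_left by blast
    then show ?thesis using e tc by blast
  qed
qed

lemma cyclic_decomposition_unique: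
  assumes "cyclically_reduced c" "cyclically_reduced d" "t @ c @ winv t = s @ d @ winv s"
  shows "t = s \<and> c = d"
  using assms(3)
proof (induction t arbitrary: s)
  case Nil
  show ?case
  proof (cases s)
    case (Cons y s')
    then have "c = y # (s' @ d @ winv s') @ [linv y]" using Nil by simp
    then show ?thesis using assms(1) by (simp add: cyclically_reduced_def)
  qed (use Nil in simp)
next
  case (Cons x t)
  show ?case
  proof (cases s)
    case Nil
    then have "d = x # (t @ c @ winv t) @ [linv x]" using Cons.prems by simp
    then show ?thesis using assms(2) by (simp add: cyclically_reduced_def)
  next
    case (Cons y s')
    then show ?thesis using Cons.prems Cons.IH[of s'] by simp
  qed
qed

lemma ex1_cyclic_decomposition:
  "\<exists>!(t, c). reduced t \<and> cyclically_reduced c \<and> reduced_form w = t @ c @ winv t"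
proof -
  obtain t c where tc: "reduced t" "cyclically_reduced c" "reduced_form w = t @ c @ winv t"
    using ex_cyclic_decomposition[OF reduced_reduced_form[of w]] by blast
  show ?thesis
  proof (rule ex1I[of _ "(t, c)"])
    fix p
    assume p: "case p of (t, c) \<Rightarrow> reduced t \<and> cyclically_reduced c \<and> reduced_form w = t @ c @ winv t"
    obtain s d where sd: "p = (s, d)" by (cases p)
    then have d: "cyclically_reduced d" "reduced_form w = s @ d @ winv s" using p by auto
    then have "s = t \<and> d = c"
      using tc(3) cyclic_decomposition_unique[OF d(1) tc(2)] by (metis (no_types))
    then show "p = (t, c)" using sd by simp
  qed (use tc in simp)
qed

lemma cyclically_reduced_form_spec:
  "cyclically_reduced (cyclically_reduced_form w) \<and>
    (\<exists>t. reduced t \<and> reduced_form w = t @ cyclically_reduced_form w @ winv t)"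
  unfolding cyclically_reduced_form_def
proof (rule theI')
  show "\<exists>!c. cyclically_reduced c \<and> (\<exists>t. reduced t \<and> reduced_form w = t @ c @ winv t)"
    using ex_cyclic_decomposition[OF reduced_reduced_form[of w]]
    by (metis cyclic_decomposition_unique)
qed

lemma cancels_words: "cancels u v \<Longrightarrow> u \<in> words X \<Longrightarrow> v \<in> words X"
  by (induction rule: cancels.induct) (auto simp: words_def)

lemma reduced_form_words: "w \<in> words X \<Longrightarrow> reduced_form w \<in> words X"
  using cancels_reduced_form[of w]
  by (induction rule: rtranclp_induct) (auto dest: cancels_words)

lemma cprod_closed:
  assumes "u \<in> words X" "v \<in> words X"
  shows "u \<circledast> v \<in> cyclically_reduced_words X"
proof -
  have "reduced_form (u @ v) \<in> words X"
    using assms by (intro reduced_form_words) (auto simp: words_def)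
  then show ?thesis
    using cyclically_reduced_form_spec[of "u @ v"]
    by (auto simp: words_def cprod_def cyclically_reduced_words_def)
qed

lemma cancels_Cons: "cancels u v \<Longrightarrow> cancels (x # u) (x # v)"
  by (metis append_Cons cancels.cases cancels.intros)

lemma cancels_rtranclp_Cons: "cancels\<^sup>*\<^sup>* u v \<Longrightarrow> cancels\<^sup>*\<^sup>* (x # u) (x # v)"
  by (induction rule: rtranclp_induct) (auto intro: cancels_Cons rtranclp.rtrancl_into_rtrancl)

(* The formal inverse represents the inverse in the free group. *)
lemma reduced_form_winv: "reduced_form (u @ winv u) = []"
proof -
  have "cancels\<^sup>*\<^sup>* (u @ winv u @ v) v" for v
  proof (induction u arbitrary: v)
    case (Cons x u)
    have "cancels\<^sup>*\<^sup>* (u @ winv u @ linv x # v) (linv x # v)" by (rule Cons.IH)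
    then have "cancels\<^sup>*\<^sup>* (x # u @ winv u @ linv x # v) (x # linv x # v)"
      by (rule cancels_rtranclp_Cons)
    moreover have "cancels (x # linv x # v) v" using cancels.intros[of "[]" x v] by simp
    ultimately show ?case by (simp add: rtranclp.rtrancl_into_rtrancl)
  qed simp
  from this[of "[]"] have "reduced [] \<and> cancels\<^sup>*\<^sup>* (u @ winv u) []" by simp
  then show ?thesis
    unfolding reduced_form_def using ex1_reduced_form by (metis (no_types, lifting) the1_equality)
qed

end

(* For a cyclically reduced u, the word uu is again cyclically reduced, so u * u = uu, which
   equals u only if u is empty. For inverses: if u * v = 1, the reduced form of uv is t t^-1
   for some t; a word t t^-1 is reduced only if t is empty, so uv = 1 already in the free
   group and v is the inverse of u there. *)
theory Submission
  imports Defs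
begin

text \<open>Trades the definite description for a computable fold: the fold is constant along
  \<open>cancels\<close> steps and fixes the reduced word where they end.\<close>

lemma reduced_form_eq_foldr: "reduced_form w = foldr push w []"
  using foldr_push_rtranclp[OF cancels_reduced_form[of w]]
    foldr_push_reduced[OF reduced_reduced_form[of w]] by simp

lemma reduced_form_reduced: "reduced w \<Longrightarrow> reduced_form w = w"
  by (simp add: reduced_form_eq_foldr foldr_push_reduced)

lemma winv_append: "winv (u @ v) = winv v @ winv u"
  by (simp add: winv_def)

lemma winv_winv [simp]: "winv (winv w) = w"
  by (simp add: winv_def rev_map comp_def)

lemma winv_eq_iff: "winv u = v \<longleftrightarrow> u = winv v"
  by auto

lemma reduced_winv: "reduced w \<Longrightarrow> reduced (winv w)"
  unfolding reduced_def
proof (intro notI, elim exE)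
  fix p x q
  assume n: "\<nexists>p x q. w = p @ [x, linv x] @ q" and "winv w = p @ [x, linv x] @ q"
  then have "w = winv (p @ [x, linv x] @ q)" by (metis winv_winv)
  \<comment> \<open>A cancelling pair is its own formal inverse, so it reappears unchanged in
    \<open>w\<close>.\<close>
  then have "w = winv q @ [x, linv x] @ winv p" by (simp add: winv_append)
  with n show False by blast
qed

lemma cyclically_reduced_winv: "cyclically_reduced w \<Longrightarrow> cyclically_reduced (winv w)"
  using reduced_winv[of w]
  by (auto simp: cyclically_reduced_def winv_def hd_rev last_rev hd_map last_map)

lemma winv_words: "w \<in> words X \<Longrightarrow> winv w \<in> words X"
  by (fastforce simp: words_def winv_def in_lists_conv_set)

lemma winv_cyclically_reduced_words:
  "w \<in> cyclically_reduced_words X \<Longrightarrow> winv w \<in> cyclically_reduced_words X"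
  by (simp add: cyclically_reduced_words_def winv_words cyclically_reduced_winv)

lemma reduced_append:
  "reduced (u @ v) \<longleftrightarrow> reduced u \<and> reduced v \<and> (u \<noteq> [] \<and> v \<noteq> [] \<longrightarrow> hd v \<noteq> linv (last u))"
  by (induction u) (auto simp: reduced_Cons hd_append)

text \<open>For nonempty \<open>t\<close>, the last letter of \<open>t\<close> meets its own inverse
  at the junction.\<close>

lemma reduced_append_winv_iff: "reduced (t @ winv t) \<longleftrightarrow> t = []"
  by (auto simp: reduced_append winv_def hd_rev last_map)

text \<open>The pair at the junction is \<open>last u\<close>, \<open>hd u\<close>, which cyclic
  reducedness keeps from cancelling; the outer letters of the square are those of
  \<open>u\<close>.\<close>

lemma cyclically_reduced_append_self: "cyclically_reduced u \<Longrightarrow> cyclically_reduced (u @ u)"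
  by (auto simp: cyclically_reduced_def reduced_append linv_eq_iff)

lemma cyclically_reduced_form_eqI:
  "cyclically_reduced c \<Longrightarrow> reduced_form w = t @ c @ winv t \<Longrightarrow> cyclically_reduced_form w = c"
  using cyclically_reduced_form_spec[of w] by (metis cyclic_decomposition_unique)

lemma cyclically_reduced_form_cyclically_reduced:
  "cyclically_reduced w \<Longrightarrow> cyclically_reduced_form w = w"
  using cyclically_reduced_form_eqI[of w w "[]"]
  by (simp add: cyclically_reduced_def reduced_form_reduced)

lemma cyclically_reduced_form_eq_Nil_iff:
  "cyclically_reduced_form w = [] \<longleftrightarrow> reduced_form w = []"
proof
  assume "cyclically_reduced_form w = []"
  then obtain t where "reduced_form w = t @ winv t"
    using cyclically_reduced_form_spec[of w] by auto
  then show "reduced_form w = []"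
    using reduced_reduced_form[of w] by (simp add: reduced_append_winv_iff)
next
  assume "reduced_form w = []"
  then show "cyclically_reduced_form w = []"
    using cyclically_reduced_form_eqI[of "[]" w "[]"] by (simp add: cyclically_reduced_def)
qed

text \<open>On reduced words, \<open>foldr push u\<close> acts as left multiplication by
  \<open>u\<close> in the free group, so the action of \<open>winv u\<close> undoes it.\<close>

lemma foldr_push_winv: "reduced w \<Longrightarrow> foldr push (winv u) (foldr push u w) = w"
proof (induction u)
  case (Cons x u)
  then show ?case
    using push_push[of "foldr push u w" "linv x"] by (simp add: reduced_foldr)
qed simp

text \<open>Serves both kinds of inverse: the product is trivial exactly when \<open>u @ v\<close>
  is already trivial in the free group.\<close>

lemma cprod_eq_Nil_iff:
  assumes "reduced u" "reduced v"
  shows "u \<circledast> v = [] \<longleftrightarrow> v = winv u"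
proof
  assume "u \<circledast> v = []"
  \<comment> \<open>Folding over \<open>u @ v\<close> first rebuilds the reduced word
    \<open>v\<close>, then lets \<open>u\<close> act on it.\<close>
  then have "foldr push u v = []"
    using foldr_push_reduced[OF assms(2)]
    by (simp add: cprod_def cyclically_reduced_form_eq_Nil_iff reduced_form_eq_foldr)
  \<comment> \<open>Let \<open>winv u\<close> act on both sides: the left becomes \<open>v\<close>,
    the right becomes \<open>winv u\<close> because that word is reduced.\<close>
  then show "v = winv u"
    using foldr_push_winv[OF assms(2), of u] foldr_push_reduced[OF reduced_winv[OF assms(1)]]
    by simp
next
  assume "v = winv u"
  then show "u \<circledast> v = []"
    by (simp add: cprod_def cyclically_reduced_form_eq_Nil_iff reduced_form_winv)
qed

lemma Nil_cyclically_reduced_words: "[] \<in> cyclically_reduced_words X"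
  by (simp add: cyclically_reduced_words_def words_def cyclically_reduced_def)

lemma identity_in_cprod: "identity_in (cyclically_reduced_words X) (\<circledast>) []"
  using Nil_cyclically_reduced_words
  by (auto simp: identity_in_def cprod_def cyclically_reduced_words_def
      cyclically_reduced_form_cyclically_reduced)

lemma idempotent_in_cprod_iff:
  "idempotent_in (cyclically_reduced_words X) (\<circledast>) e \<longleftrightarrow> e = []"
proof
  assume "idempotent_in (cyclically_reduced_words X) (\<circledast>) e"
  then have "cyclically_reduced e" "e \<circledast> e = e"
    by (auto simp: idempotent_in_def cyclically_reduced_words_def)
  \<comment> \<open>The square needs no reduction, so idempotency reads
    \<open>e @ e = e\<close>.\<close>
  then show "e = []"
    by (simp add: cprod_def cyclically_reduced_append_self
        cyclically_reduced_form_cyclically_reduced)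
next
  assume "e = []"
  then show "idempotent_in (cyclically_reduced_words X) (\<circledast>) e"
    using identity_in_cprod by (auto simp: idempotent_in_def identity_in_def)
qed

text \<open>Uniqueness is inherited from idempotents, since any identity is idempotent.\<close>

lemma identity_in_cprod_iff:
  "identity_in (cyclically_reduced_words X) (\<circledast>) e \<longleftrightarrow> e = []"
proof
  assume "identity_in (cyclically_reduced_words X) (\<circledast>) e"
  then have "idempotent_in (cyclically_reduced_words X) (\<circledast>) e"
    by (simp add: identity_in_def idempotent_in_def)
  then show "e = []" by (simp add: idempotent_in_cprod_iff)
qed (simp add: identity_in_cprod)

lemma right_inverse_in_cprod_iff:
  assumes "u \<in> cyclically_reduced_words X"
  shows "right_inverse_in (cyclically_reduced_words X) (\<circledast>) [] u v \<longleftrightarrow> v = winv u"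
  using assms winv_cyclically_reduced_words[OF assms] cprod_eq_Nil_iff[of u v]
  by (auto simp: right_inverse_in_def cyclically_reduced_words_def cyclically_reduced_def)

lemma left_inverse_in_cprod_iff:
  assumes "u \<in> cyclically_reduced_words X"
  shows "left_inverse_in (cyclically_reduced_words X) (\<circledast>) [] u v \<longleftrightarrow> v = winv u"
proof -
  \<comment> \<open>The criterion with the factors swapped yields \<open>u = winv v\<close>;
    \<open>winv\<close> is an involution, which turns this around.\<close>
  have "v \<circledast> u = [] \<longleftrightarrow> v = winv u" if "v \<in> cyclically_reduced_words X"
    using assms that cprod_eq_Nil_iff[of v u] winv_eq_iff[of v u]
    by (simp add: cyclically_reduced_words_def cyclically_reduced_def eq_commute[of u])
  then show ?thesis
    using winv_cyclically_reduced_words[OF assms] by (auto simp: left_inverse_in_def)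
qed

theorem mainTheorem3:
  fixes X :: "'a set"
  shows
    "(\<forall>w\<in>words X. w \<circledast> [] = cyclically_reduced_form w \<and> [] \<circledast> w = cyclically_reduced_form w)
     \<and> identity_in (cyclically_reduced_words X) (\<circledast>) []
     \<and> (\<forall>e. idempotent_in (cyclically_reduced_words X) (\<circledast>) e \<longleftrightarrow> e = [])
     \<and> (\<forall>e. identity_in (cyclically_reduced_words X) (\<circledast>) e \<longleftrightarrow> e = [])
     \<and> (\<forall>u\<in>cyclically_reduced_words X.
          (\<forall>v. left_inverse_in (cyclically_reduced_words X) (\<circledast>) [] u v \<longleftrightarrow> v = winv u)
          \<and> (\<forall>v. right_inverse_in (cyclically_reduced_words X) (\<circledast>) [] u v \<longleftrightarrow> v = winv u))"
  by (simp add: identity_in_cprod_iff idempotent_in_cprod_iff left_inverse_in_cprod_iff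
      right_inverse_in_cprod_iff cprod_def)

end
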